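(* For each integer $m\ge 5$ let $\ell=\ell(m):=\lfloor m^{1/2.01}\rfloor$, $R=R(m):=\lfloor m^{1/2}\rfloor$, $t=t(m):=\binom{\ell+R}{R}$ and $A=A(m):=\{0,1,m-\ell+1,m-\ell+2,\ldots,m\}$. Then $t^{1/\ell}\to\infty$ as $m\to\infty$, and $$h_t(A)\sim \frac{1}{e}\,m\,\ell\,t^{1/\ell}\qquad (m\to\infty),$$ i.e. the ratio of the two sides tends to $1$ as $m\to\infty$.
   Context: For an integer $N\ge 0$, $[N]:=\{0,1,\ldots,N\}$. For a set $X$ of integers and an integer $N$, $N-X:=\{N-x : x\in X\}$. For a finite set $A$ of non-negative integers with $\min A=0$, maximum $m$ and $\gcd(A)=1$, and integers $h,t\geq 1$, $r_{A,h}(n)$ is the number of $(k_a)_{a\in A}\in\mathbb{Z}_{\geq 0}^{A}$ with $\sum_{a\in A}k_a a=n$ and $\sum_{a\in A}k_a=h$; $(hA)^{(t)}:=\{n\in\mathbb{Z}_{\geq 0} : r_{A,h}(n)\geq t\}$; $\mathcal{P}_t(A):=\bigcup_{h\geq 1}(hA)^{(t)}$; $\mathcal{E}_t(A):=\mathbb{Z}_{\geq 0}\setminus\mathcal{P}_t(A)$; the same definitions are applied to $m-A$. $h_t(A)$ denotes the smallest integer $h_t\ge 1$ such that $(hA)^{(t)}=[hm]\setminus\big(\mathcal{E}_t(A)\cup(hm-\mathcal{E}_t(m-A))\big)$ for every integer $h\geq h_t$. *)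

theory Defs
  imports Complex_Main "HOL-Library.FuncSet" "HOL-Library.Landau_Symbols"
begin

(* Everything lives in int, not nat: N - X may contain negative elements,
   which truncated subtraction would turn into a spurious 0. *)

definition initial_segment :: "int \<Rightarrow> int set" where
  "initial_segment N = {0..N}"

definition reflect :: "int \<Rightarrow> int set \<Rightarrow> int set" where
  "reflect N X = (\<lambda>x. N - x) ` X"

(* Families (k_a) indexed by A are the extensional functions on A. For finite A the set below
   is finite, so card counts it. *)
definition rep_count :: "int set \<Rightarrow> nat \<Rightarrow> int \<Rightarrow> nat" where
  "rep_count A h n =
     card {k \<in> A \<rightarrow>\<^sub>E (UNIV :: nat set).
             (\<Sum>a\<in>A. int (k a) * a) = n \<and> (\<Sum>a\<in>A. k a) = h}"

definition sumset_rep :: "nat \<Rightarrow> int set \<Rightarrow> nat \<Rightarrow> int set" where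
  "sumset_rep h A t = {n. 0 \<le> n \<and> t \<le> rep_count A h n}"

definition popular :: "nat \<Rightarrow> int set \<Rightarrow> int set" where
  "popular t A = (\<Union>h\<in>{1..}. sumset_rep h A t)"

definition exceptional :: "nat \<Rightarrow> int set \<Rightarrow> int set" where
  "exceptional t A = {0..} - popular t A"

definition structure_at :: "nat \<Rightarrow> int set \<Rightarrow> nat \<Rightarrow> bool" where
  "structure_at t A h \<longleftrightarrow>
     sumset_rep h A t =
       initial_segment (int h * Max A)
         - (exceptional t A \<union> reflect (int h * Max A) (exceptional t (reflect (Max A) A)))"

definition threshold :: "nat \<Rightarrow> int set \<Rightarrow> nat" where
  "threshold t A = (LEAST h0. 1 \<le> h0 \<and> (\<forall>h\<ge>h0. structure_at t A h))"

definition ell :: "nat \<Rightarrow> nat" where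
  "ell m = nat \<lfloor>real m powr (1 / 2.01)\<rfloor>"

definition R_par :: "nat \<Rightarrow> nat" where
  "R_par m = nat \<lfloor>real m powr (1 / 2)\<rfloor>"

definition t_par :: "nat \<Rightarrow> nat" where
  "t_par m = (ell m + R_par m) choose R_par m"

definition A_set :: "nat \<Rightarrow> int set" where
  "A_set m = {0, 1} \<union> {int m - int (ell m) + 1..int m}"

end

theory Submission
  imports Defs "HOL-Real_Asymp.Real_Asymp"
begin

text \<open>
  Write \<open>l = ell m\<close>, \<open>R = R_par m\<close> and call the \<open>l\<close> elements \<open>m - l + 1, \<dots>, m\<close> of \<open>A\<close> large.
  The number \<open>t = (l + R) choose R\<close> counts the multisets of at most \<open>R\<close> large elements. Since
  \<open>t\<close> has an \<open>l\<close>-th root asymptotic to \<open>e R / l\<close>, the claim says that the threshold is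
  asymptotic to \<open>m R\<close>.

  Lower bound (\<open>structure_fails_before\<close>). A representation of \<open>n = m R\<close> uses at most \<open>R\<close> large
  elements because \<open>(R + 1) (m - l + 1) > m R\<close>; conversely each multiset of at most \<open>R\<close> large
  elements is completed in exactly one way by copies of \<open>1\<close>. So \<open>n\<close> has exactly \<open>t\<close>
  representations if zeros are not counted, and one of them, consisting of ones only, has length
  \<open>m R\<close>. With \<open>h = m R - 1\<close> that representation is lost, although \<open>n\<close> is popular for \<open>A\<close> and
  \<open>h m - n\<close> is popular for the reflected set.

  Upper bound (\<open>structure_at_A_set\<close>). Let \<open>M\<close> be slightly larger than \<open>R\<close>, so that there are at
  least \<open>t\<close> multisets of at most \<open>M\<close> elements from \<open>m - l + 1, \<dots>, m - 2\<close>, and let \<open>h \<ge> m M\<close>.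
  If \<open>n \<le> h\<close>, length is no constraint and popularity of \<open>n\<close> suffices; if \<open>h m - n \<le> h\<close>, the same
  holds on the reflected side. For all other \<open>n\<close>, each of these multisets is completed to a
  representation of \<open>n\<close> of length \<open>h\<close>: copies of \<open>m\<close> bring the sum near \<open>n\<close>, and the
  remaining gap is closed by copies of \<open>1\<close> (\<open>rep_count_ge_small\<close>), or, where there is no room for
  ones, by copies of \<open>m - 1\<close> (\<open>rep_count_ge_large\<close>).

  One may take \<open>M = R + m\<^bsup>2/5\<^esup>\<close> up to rounding (\<open>eventually_t_par_le\<close>), and then \<open>M \<sim> R\<close>, so that
  both bounds agree asymptotically.
\<close>

section \<open>Counting multisets\<close>

definition reps :: "int set \<Rightarrow> nat \<Rightarrow> int \<Rightarrow> (int \<Rightarrow> nat) set" where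
  "reps A h n = {k \<in> A \<rightarrow>\<^sub>E UNIV. (\<Sum>a\<in>A. int (k a) * a) = n \<and> (\<Sum>a\<in>A. k a) = h}"

text \<open>
  A multiset over \<open>B\<close> is encoded by its multiplicity function, made extensional so that equality
  of functions is equality of multisets, as in \<open>rep_count\<close>.
\<close>
definition multisets_upto :: "'a set \<Rightarrow> nat \<Rightarrow> ('a \<Rightarrow> nat) set" where
  "multisets_upto B M = {k \<in> B \<rightarrow>\<^sub>E UNIV. sum k B \<le> M}"

lemma rep_count_eq_card_reps: "rep_count A h n = card (reps A h n)"
  by (simp add: rep_count_def reps_def)

lemma sum_choose_shift: "(\<Sum>i\<le>M. (i + b) choose b) = (M + Suc b) choose (Suc b)"
  by (induction M) auto

lemma multisets_upto_insert:
  assumes "finite B" "x \<notin> B"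
  shows "multisets_upto (insert x B) M =
    (\<lambda>(i, k). k(x := i)) ` (SIGMA i:{..M}. multisets_upto B (M - i))" (is "?l = ?r")
proof
  show "?l \<subseteq> ?r"
  proof
    fix k assume k: "k \<in> ?l"
    have s: "sum k (insert x B) = k x + sum k B"
      using assms by simp
    have "restrict k B \<in> multisets_upto B (M - k x)"
      using k s by (auto simp: multisets_upto_def)
    moreover have "k x \<le> M"
      using k s by (auto simp: multisets_upto_def)
    moreover have "k = (restrict k B)(x := k x)"
      using k by (auto simp: multisets_upto_def fun_eq_iff PiE_def extensional_def)
    ultimately show "k \<in> ?r"
      by (intro image_eqI[of _ _ "(k x, restrict k B)"]) auto
  qed
next
  show "?r \<subseteq> ?l"
  proof clarify
    fix i k assume i: "i \<le> M" and k: "k \<in> multisets_upto B (M - i)"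
    have "sum (k(x := i)) B = sum k B"
      using assms by (intro sum.cong) auto
    then show "k(x := i) \<in> ?l"
      using i k assms by (auto simp: multisets_upto_def PiE_def extensional_def)
  qed
qed

text \<open>
  Stars and bars: splitting by the multiplicity of one element turns the count into the
  hockey-stick sum.
\<close>
lemma finite_card_multisets_upto:
  assumes "finite B"
  shows "finite (multisets_upto B M) \<and> card (multisets_upto B M) = (M + card B) choose card B"
  using assms
proof (induction B arbitrary: M)
  case empty
  have "multisets_upto ({} :: 'a set) M = {\<lambda>_. undefined}"
    by (auto simp: multisets_upto_def)
  then show ?case by simp
next
  case (insert x B)
  have inj: "inj_on (\<lambda>(i, k). k(x := i)) (SIGMA i:{..M}. multisets_upto B (M - i))"
  proof (rule inj_onI, clarify)
    fix i j :: nat and k k' :: "'a \<Rightarrow> nat"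
    assume mem: "k \<in> multisets_upto B (M - i)" "k' \<in> multisets_upto B (M - j)"
      and eq: "k(x := i) = k'(x := j)"
    have "k y = k' y" for y
    proof (cases "y = x")
      case True
      then show ?thesis
        using mem insert.hyps by (auto simp: multisets_upto_def PiE_def extensional_def)
    next
      case False
      then show ?thesis using fun_cong[OF eq, of y] by simp
    qed
    moreover have "i = j" using fun_cong[OF eq, of x] by simp
    ultimately show "i = j \<and> k = k'" by auto
  qed
  have "card (multisets_upto (insert x B) M)
      = (\<Sum>i\<le>M. card (multisets_upto B (M - i)))"
    using insert by (simp add: multisets_upto_insert card_image[OF inj])
  also have "\<dots> = (\<Sum>i\<le>M. ((M - i) + card B) choose card B)"
    using insert by simp
  also have "\<dots> = (\<Sum>i\<le>M. (i + card B) choose card B)"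
    by (rule sum.reindex_bij_witness[of _ "\<lambda>i. M - i" "\<lambda>i. M - i"]) auto
  finally show ?case
    using insert by (simp add: multisets_upto_insert sum_choose_shift)
qed

lemmas finite_multisets_upto = finite_card_multisets_upto[THEN conjunct1]
lemmas card_multisets_upto = finite_card_multisets_upto[THEN conjunct2]

section \<open>Representation counts\<close>

lemma finite_reps: "finite A \<Longrightarrow> finite (reps A h n)"
  by (rule finite_subset[OF _ finite_multisets_upto[of A h]])
     (auto simp: reps_def multisets_upto_def)

text \<open>
  The tool for all lower bounds: restriction to \<open>B\<close> recovers the multiset from its completion,
  so different multisets yield different representations.
\<close>
lemma rep_count_ge_choose:
  assumes "finite A" "B \<subseteq> A"
    and ext: "\<And>k. k \<in> multisets_upto B M \<Longrightarrow> \<exists>k'\<in>reps A h n. \<forall>b\<in>B. k' b = k b"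
  shows "(M + card B) choose card B \<le> rep_count A h n"
proof -
  have "multisets_upto B M \<subseteq> (\<lambda>k'. restrict k' B) ` reps A h n"
  proof
    fix k assume k: "k \<in> multisets_upto B M"
    with ext obtain k' where k': "k' \<in> reps A h n" "\<forall>b\<in>B. k' b = k b" by blast
    have "k = restrict k' B"
      using k k' by (auto simp: fun_eq_iff multisets_upto_def PiE_def extensional_def)
    with k' show "k \<in> (\<lambda>k'. restrict k' B) ` reps A h n" by auto
  qed
  then have "card (multisets_upto B M) \<le> card (reps A h n)"
    using finite_reps[OF \<open>finite A\<close>] by (rule surj_card_le[rotated])
  moreover have "finite B" using assms by (auto intro: finite_subset)
  ultimately show ?thesis by (simp add: card_multisets_upto rep_count_eq_card_reps)
qed

text \<open>
  Replacing every summand \<open>a\<close> by \<open>m - a\<close> is a bijection between representations.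
\<close>
lemma rep_count_reflect:
  assumes "finite A"
  shows "rep_count (reflect m A) h (int h * m - n) = rep_count A h n"
proof -
  have *: "card (reps A h n) \<le> card (reps (reflect m A) h (int h * m - n))"
    if "finite A" for A n
  proof (rule card_inj_on_le)
    let ?g = "\<lambda>k. restrict (\<lambda>b. k (m - b)) (reflect m A)"
    have re: "(\<Sum>b\<in>reflect m A. f b) = (\<Sum>a\<in>A. f (m - a))" for f :: "int \<Rightarrow> 'c::comm_monoid_add"
      unfolding reflect_def by (subst sum.reindex) (auto simp: inj_on_def)
    have mem: "b \<in> reflect m A \<longleftrightarrow> m - b \<in> A" for b
      unfolding reflect_def by force
    show "inj_on ?g (reps A h n)"
    proof (rule inj_onI)
      fix k k' assume k: "k \<in> reps A h n" "k' \<in> reps A h n" "?g k = ?g k'"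
      show "k = k'"
      proof
        fix a show "k a = k' a"
          using k(1,2) fun_cong[OF k(3), of "m - a"]
          by (cases "a \<in> A") (auto simp: reps_def PiE_def extensional_def mem)
      qed
    qed
    show "?g ` reps A h n \<subseteq> reps (reflect m A) h (int h * m - n)"
    proof clarify
      fix k assume k: "k \<in> reps A h n"
      have "(\<Sum>a\<in>A. int (k a) * (m - a)) = int (\<Sum>a\<in>A. k a) * m - (\<Sum>a\<in>A. int (k a) * a)"
        by (simp add: algebra_simps sum_subtractf sum_distrib_left)
      then show "?g k \<in> reps (reflect m A) h (int h * m - n)"
        using k by (auto simp: reps_def re mem)
    qed
    show "finite (reps (reflect m A) h (int h * m - n))"
      using that by (intro finite_reps) (simp add: reflect_def)
  qed
  have "reflect m (reflect m A) = A"
    by (auto simp: reflect_def image_image)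
  then show ?thesis
    using *[OF assms, of n] *[of "reflect m A" "int h * m - n"] assms
    by (simp add: rep_count_eq_card_reps reflect_def)
qed

text \<open>
  A representation of \<open>n\<close> has at most \<open>n\<close> nonzero summands, so once \<open>h \<ge> n\<close> the number of zeros
  can be adjusted freely to reach length \<open>h\<close>.
\<close>
lemma rep_count_le_of_le_length:
  assumes "finite A" "0 \<in> A" "A \<subseteq> {0..}" "n \<le> int h"
  shows "rep_count A h' n \<le> rep_count A h n"
  unfolding rep_count_eq_card_reps
proof (rule card_inj_on_le)
  let ?g = "\<lambda>k::int \<Rightarrow> nat. k(0 := k 0 + h - h')"
  have large: "h' \<le> k 0 + h" if k: "k \<in> reps A h' n" for k
  proof -
    have "int (\<Sum>a\<in>A - {0}. k a) \<le> (\<Sum>a\<in>A - {0}. int (k a) * a)"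
      unfolding of_nat_sum
    proof (rule sum_mono)
      fix a assume "a \<in> A - {0}"
      then have "1 \<le> a" using assms(3) by fastforce
      then show "int (k a) \<le> int (k a) * a"
        using mult_left_mono[of 1 a "int (k a)"] by simp
    qed
    also have "\<dots> = n"
      using k assms by (simp add: reps_def sum.remove[of A 0])
    finally have "(\<Sum>a\<in>A - {0}. k a) \<le> h" using assms by linarith
    moreover have "h' = k 0 + (\<Sum>a\<in>A - {0}. k a)"
      using k assms by (simp add: reps_def sum.remove[of A 0])
    ultimately show ?thesis by simp
  qed
  show "inj_on ?g (reps A h' n)"
  proof (rule inj_onI)
    fix k k' assume k: "k \<in> reps A h' n" "k' \<in> reps A h' n" "?g k = ?g k'"
    show "k = k'"
    proof
      fix a show "k a = k' a"
        using fun_cong[OF k(3), of a] large[OF k(1)] large[OF k(2)] by (cases "a = 0") auto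
    qed
  qed
  show "?g ` reps A h' n \<subseteq> reps A h n"
  proof clarify
    fix k assume k: "k \<in> reps A h' n"
    have "sum (?g k) (A - {0}) = sum k (A - {0})"
      "(\<Sum>a\<in>A - {0}. int (?g k a) * a) = (\<Sum>a\<in>A - {0}. int (k a) * a)"
      by (intro sum.cong; simp)+
    then show "?g k \<in> reps A h n"
      using k large[OF k] assms by (auto simp: reps_def sum.remove[of A 0] PiE_def extensional_def)
  qed
  show "finite (reps A h n)" using assms finite_reps by blast
qed

lemma popular_iff: "n \<in> popular t A \<longleftrightarrow> 0 \<le> n \<and> (\<exists>h\<ge>1. t \<le> rep_count A h n)"
  by (auto simp: popular_def sumset_rep_def)

text \<open>
  One inclusion of the structure equation is automatic: a number with \<open>t\<close> representations of
  length \<open>h\<close> is popular, and so is its reflection.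
\<close>
lemma structure_at_iff:
  assumes "finite A" "A \<subseteq> {0..Max A}" "1 \<le> h" "1 \<le> t"
  shows "structure_at t A h \<longleftrightarrow>
    (\<forall>n. 0 \<le> n \<and> n \<le> int h * Max A \<and> n \<in> popular t A \<and>
         int h * Max A - n \<in> popular t (reflect (Max A) A) \<longrightarrow> t \<le> rep_count A h n)"
proof -
  let ?m = "Max A"
  have bound: "n \<le> int h * ?m" if "t \<le> rep_count A h n" for n
  proof -
    have "reps A h n \<noteq> {}"
      using that assms(4) by (auto simp: rep_count_eq_card_reps)
    then obtain k where k: "k \<in> reps A h n" by blast
    have "n = (\<Sum>a\<in>A. int (k a) * a)" using k by (simp add: reps_def)
    also have "\<dots> \<le> (\<Sum>a\<in>A. int (k a) * ?m)"
      using assms by (intro sum_mono mult_left_mono) auto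
    also have "\<dots> = int (\<Sum>a\<in>A. k a) * ?m" by (simp add: sum_distrib_right)
    also have "\<dots> = int h * ?m" using k by (simp add: reps_def)
    finally show ?thesis .
  qed
  have pop: "n \<in> popular t A \<and> int h * ?m - n \<in> popular t (reflect ?m A)"
    if "t \<le> rep_count A h n" "0 \<le> n" for n
    using that bound[of n] assms rep_count_reflect[of A ?m h n]
    by (auto simp: popular_iff intro!: exI[of _ h])
  have "n \<in> reflect (int h * ?m) X \<longleftrightarrow> int h * ?m - n \<in> X" for n X
    unfolding reflect_def by force
  then have mem: "n \<in> initial_segment (int h * ?m)
         - (exceptional t A \<union> reflect (int h * ?m) (exceptional t (reflect ?m A))) \<longleftrightarrow>
     0 \<le> n \<and> n \<le> int h * ?m \<and> n \<in> popular t A \<and>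
         int h * ?m - n \<in> popular t (reflect ?m A)" for n
    by (auto simp: initial_segment_def exceptional_def)
  have "structure_at t A h \<longleftrightarrow> (\<forall>n. n \<in> sumset_rep h A t \<longleftrightarrow>
     0 \<le> n \<and> n \<le> int h * ?m \<and> n \<in> popular t A \<and>
         int h * ?m - n \<in> popular t (reflect ?m A))"
    unfolding structure_at_def set_eq_iff mem ..
  also have "\<dots> \<longleftrightarrow> (\<forall>n. 0 \<le> n \<and> n \<le> int h * ?m \<and> n \<in> popular t A \<and>
         int h * ?m - n \<in> popular t (reflect ?m A) \<longrightarrow> t \<le> rep_count A h n)"
    unfolding sumset_rep_def using pop bound by blast
  finally show ?thesis .
qed

section \<open>Structure for large lengths\<close>

text \<open>
  The large elements with \<open>m\<close> and \<open>m - 1\<close> set aside: these two, together with \<open>0\<close> and \<open>1\<close>, serve to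
  complete a multiset over the core to a representation.
\<close>
abbreviation "core m \<equiv> {int m - int (ell m) + 1..int m - 2}"

lemma A_set_split:
  assumes "3 \<le> ell m" "ell m < m"
  shows "A_set m = {0, 1, int m - 1, int m} \<union> core m"
  using assms by (auto simp: A_set_def)

lemma sum_A_set:
  assumes "3 \<le> ell m" "ell m < m"
  shows "sum f (A_set m) = f 0 + f 1 + f (int m - 1) + f (int m) + sum f (core m)"
proof -
  have "sum f (A_set m) = sum f {0, 1, int m - 1, int m} + sum f (core m)"
    unfolding A_set_split[OF assms] using assms by (intro sum.union_disjoint) auto
  also have "sum f {0, 1, int m - 1, int m} = f 0 + f 1 + f (int m - 1) + f (int m)"
    using assms by (simp add: add.assoc)
  finally show ?thesis .
qed

lemma Max_A_set: "ell m \<ge> 1 \<Longrightarrow> m \<ge> 1 \<Longrightarrow> Max (A_set m) = int m"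
  by (intro Max_eqI) (auto simp: A_set_def)

lemma A_set_subset: "ell m \<le> m \<Longrightarrow> m \<ge> 1 \<Longrightarrow> A_set m \<subseteq> {0..int m}"
  by (auto simp: A_set_def)

lemma finite_A_set [simp]: "finite (A_set m)"
  by (simp add: A_set_def)

text \<open>
  A multiset over the core enters only through its size \<open>K\<close> and its deficit \<open>D\<close>, its sum being
  \<open>K m - D\<close>. Each deficit \<open>m - a\<close> lies between \<open>1\<close> and \<open>l - 1\<close>, which gives \<open>K \<le> D \<le> m\<close>.
  The multiplicities of \<open>0\<close>, \<open>1\<close>, \<open>m - 1\<close> and \<open>m\<close> are \<open>c0\<close>, \<open>c1\<close>, \<open>c2\<close> and \<open>c3\<close>.
\<close>
lemma rep_count_ge_of_completion:
  assumes l: "3 \<le> ell m" "ell m < m" and M: "(ell m - 1) * M \<le> m"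
    and completion: "\<And>K D. 0 \<le> K \<Longrightarrow> K \<le> int M \<Longrightarrow> K \<le> D \<Longrightarrow> D \<le> int m \<Longrightarrow>
      \<exists>c0 c1 c2 c3. int c0 + int c1 + int c2 + int c3 + K = int h \<and>
         int c1 + int c2 * (int m - 1) + int c3 * int m + (K * int m - D) = n"
  shows "(M + (ell m - 2)) choose (ell m - 2) \<le> rep_count (A_set m) h n"
proof -
  have card: "card (core m) = ell m - 2" using l by auto
  show ?thesis unfolding card[symmetric]
  proof (rule rep_count_ge_choose)
    fix k assume k: "k \<in> multisets_upto (core m) M"
    define K where "K = (\<Sum>a\<in>core m. int (k a))"
    define D where "D = (\<Sum>a\<in>core m. int (k a) * (int m - a))"
    have KM: "K \<le> int M" using k unfolding K_def of_nat_sum[symmetric] of_nat_le_iff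
      by (simp add: multisets_upto_def)
    have "K \<le> D" unfolding K_def D_def
    proof (rule sum_mono)
      fix a assume "a \<in> core m"
      then show "int (k a) \<le> int (k a) * (int m - a)"
        using mult_left_mono[of 1 "int m - a" "int (k a)"] by simp
    qed
    moreover have "D \<le> int m"
    proof -
      have "D \<le> (\<Sum>a\<in>core m. int (k a) * int (ell m - 1))"
        unfolding D_def using l by (intro sum_mono mult_left_mono) auto
      also have "\<dots> = K * int (ell m - 1)" by (simp add: K_def sum_distrib_right)
      also have "\<dots> \<le> int M * int (ell m - 1)" using KM by (rule mult_right_mono) simp
      also have "\<dots> \<le> int m" using M by (metis mult.commute of_nat_le_iff of_nat_mult)
      finally show ?thesis .
    qed
    moreover have "0 \<le> K" by (simp add: K_def sum_nonneg)
    ultimately obtain c0 c1 c2 c3 where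
      c: "int c0 + int c1 + int c2 + int c3 + K = int h"
         "int c1 + int c2 * (int m - 1) + int c3 * int m + (K * int m - D) = n"
      using completion[of K D] KM by blast
    have KD: "(\<Sum>a\<in>core m. int (k a) * a) = K * int m - D"
      by (simp add: K_def D_def right_diff_distrib sum_subtractf sum_distrib_right)
    define k' where "k' = (\<lambda>a. if a \<in> core m then k a else if a = 0 then c0 else if a = 1 then c1
      else if a = int m - 1 then c2 else if a = int m then c3 else undefined)"
    have k'_core: "k' a = k a" if "a \<in> core m" for a using that by (simp add: k'_def)
    have k'_ends: "k' 0 = c0" "k' 1 = c1" "k' (int m - 1) = c2" "k' (int m) = c3"
      using l by (auto simp: k'_def)
    have "int (sum k' (A_set m)) = int h"
      unfolding sum_A_set[OF l] k'_ends using c(1) by (simp add: K_def k'_core)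
    then have "sum k' (A_set m) = h" by (rule of_nat_eq_iff[THEN iffD1])
    moreover have "(\<Sum>a\<in>A_set m. int (k' a) * a) = n"
      unfolding sum_A_set[OF l] k'_ends using c(2) KD by (simp add: k'_core)
    moreover have "k' \<in> A_set m \<rightarrow>\<^sub>E UNIV"
      using A_set_split[OF l] by (auto simp: k'_def PiE_def extensional_def)
    ultimately have "k' \<in> reps (A_set m) h n" unfolding reps_def by blast
    then show "\<exists>k'\<in>reps (A_set m) h n. \<forall>b\<in>core m. k' b = k b"
      using k'_core by blast
  qed (use A_set_split[OF l] in auto)
qed

text \<open>
  Take \<open>s = n div m\<close> large elements in total, filling up with copies of \<open>m\<close>. The sum falls short
  of \<open>n\<close> by less than \<open>m + D \<le> 2 m\<close>, and at most that many ones repair it; the bound on \<open>h m - n\<close> is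
  what leaves room for them.
\<close>
lemma rep_count_ge_small:
  assumes l: "3 \<le> ell m" "ell m < m" and M: "(ell m - 1) * M \<le> m"
    and n: "int m * int M \<le> n" "2 * int m * int m \<le> int h * int m - n"
  shows "(M + (ell m - 2)) choose (ell m - 2) \<le> rep_count (A_set m) h n"
proof (rule rep_count_ge_of_completion[OF l M])
  fix K D :: int assume K: "0 \<le> K" "K \<le> int M" "K \<le> D" "D \<le> int m"
  define s where "s = n div int m"
  have m: "int m > 0" using l by simp
  have s: "s * int m \<le> n" "n < s * int m + int m"
    using div_mult_mod_eq[of n "int m"] pos_mod_sign[OF m, of n] pos_mod_bound[OF m, of n]
    unfolding s_def by linarith+
  have sM: "int M \<le> s" using n(1) m
    by (metis s_def mult.commute nonzero_mult_div_cancel_right zdiv_mono1 less_irrefl)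
  have "(s + 2 * int m) * int m \<le> int h * int m" using s n by (simp add: algebra_simps)
  then have sh: "s + 2 * int m \<le> int h" using m by simp
  show "\<exists>c0 c1 c2 c3. int c0 + int c1 + int c2 + int c3 + K = int h \<and>
         int c1 + int c2 * (int m - 1) + int c3 * int m + (K * int m - D) = n"
    using K s sM sh
    by (intro exI[of _ "nat (int h - s - (n - s * int m + D))"]
        exI[of _ "nat (n - s * int m + D)"] exI[of _ 0] exI[of _ "nat (s - K)"])
       (simp add: algebra_simps)
qed

text \<open>
  Here ones may not fit. Take \<open>s = n div m + 2\<close> large elements instead, whose sum may now exceed
  \<open>n\<close>: the total deficit has to be \<open>s m - n\<close>, which lies between \<open>m\<close> and \<open>2 m\<close> and hence is at
  least \<open>D\<close>; copies of \<open>m - 1\<close> supply the rest, one unit each. This never asks for more than \<open>s\<close>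
  elements, because those of positive deficit number at most \<open>2 m \<le> s\<close>.
\<close>
lemma rep_count_ge_large:
  assumes l: "3 \<le> ell m" "ell m < m" and M: "(ell m - 1) * M \<le> m"
    and n: "2 * int m * int m \<le> n" "2 * int m \<le> int h * int m - n"
  shows "(M + (ell m - 2)) choose (ell m - 2) \<le> rep_count (A_set m) h n"
proof (rule rep_count_ge_of_completion[OF l M])
  fix K D :: int assume K: "0 \<le> K" "K \<le> int M" "K \<le> D" "D \<le> int m"
  define s where "s = n div int m + 2"
  have m: "int m > 0" using l by simp
  have s0: "(s - 2) * int m \<le> n" "n < (s - 2) * int m + int m"
    using div_mult_mod_eq[of n "int m"] pos_mod_sign[OF m, of n] pos_mod_bound[OF m, of n]
    unfolding s_def add_diff_cancel_right' by linarith+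
  then have s: "int m < s * int m - n" "s * int m - n \<le> 2 * int m"
    by (simp_all add: algebra_simps)
  have "s * int m \<le> int h * int m" using s n by linarith
  then have sh: "s \<le> int h" using m by simp
  have "2 * int m * int m \<le> s * int m" using s n by linarith
  then have s2: "2 * int m \<le> s" using m by simp
  show "\<exists>c0 c1 c2 c3. int c0 + int c1 + int c2 + int c3 + K = int h \<and>
         int c1 + int c2 * (int m - 1) + int c3 * int m + (K * int m - D) = n"
    using K s sh s2
    by (intro exI[of _ "nat (int h - s)"] exI[of _ 0] exI[of _ "nat (s * int m - n - D)"]
        exI[of _ "nat (s - K - (s * int m - n - D))"])
       (simp add: algebra_simps)
qed

text \<open>
  If neither \<open>n\<close> nor \<open>h m - n\<close> is at most \<open>h\<close>, then the larger of the two is at least \<open>2 m\<^sup>2\<close>, because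
  they sum to \<open>h m \<ge> 4 m\<^sup>2\<close>.
\<close>
lemma structure_at_A_set:
  assumes l: "3 \<le> ell m" "ell m < m" and M: "(ell m - 1) * M \<le> m" "4 \<le> M"
    and t: "1 \<le> t" "t \<le> (M + (ell m - 2)) choose (ell m - 2)" and h: "m * M \<le> h"
  shows "structure_at t (A_set m) h"
proof -
  have Max: "Max (A_set m) = int m" using l by (intro Max_A_set) auto
  have sub: "A_set m \<subseteq> {0..int m}" using l by (intro A_set_subset) auto
  have refl: "reflect (int m) (A_set m) \<subseteq> {0..}" "0 \<in> reflect (int m) (A_set m)"
      "finite (reflect (int m) (A_set m))"
    using sub l by (auto simp: reflect_def A_set_def)
  have hM: "int m * int M \<le> int h" using h by (metis of_nat_le_iff of_nat_mult)
  have m4: "4 * int m \<le> int m * int M"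
    using M(2) mult_left_mono[of 4 "int M" "int m"] by simp
  have "t \<le> rep_count (A_set m) h n"
    if n: "n \<in> popular t (A_set m)"
      "int h * int m - n \<in> popular t (reflect (int m) (A_set m))" for n
  proof -
    consider "n \<le> int h" | "int h * int m - n \<le> int h"
      | "n > int h" "2 * int m * int m \<le> int h * int m - n"
      | "int h * int m - n > int h" "2 * int m * int m \<le> n"
    proof -
      have "4 * int m * int m \<le> int h * int m" using m4 hM by (intro mult_right_mono) auto
      then show ?thesis using that by linarith
    qed
    then show ?thesis
    proof cases
      case 1
      with n sub rep_count_le_of_le_length[of "A_set m" n h] show ?thesis
        by (auto simp: popular_iff A_set_def intro: order_trans)
    next
      case 2
      with n refl have "t \<le> rep_count (reflect (int m) (A_set m)) h (int h * int m - n)"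
        by (auto simp: popular_iff intro: order_trans rep_count_le_of_le_length)
      then show ?thesis by (simp add: rep_count_reflect)
    next
      case 3
      with hM t rep_count_ge_small[OF l M(1), of n h] show ?thesis by simp
    next
      case 4
      with hM m4 t rep_count_ge_large[OF l M(1), of n h] show ?thesis by simp
    qed
  qed
  moreover have "1 \<le> h" using l M h by (cases h) auto
  ultimately show ?thesis
    using sub t by (subst structure_at_iff) (auto simp: Max)
qed

section \<open>Failure at length m R - 1, and bounds for the threshold\<close>

lemma sum_A_set_large:
  assumes "1 \<le> ell m" "ell m < m"
  shows "sum f (A_set m) = f 0 + f 1 + sum f {int m - int (ell m) + 1..int m}"
proof -
  have "sum f (A_set m) = sum f {0, 1} + sum f {int m - int (ell m) + 1..int m}"
    unfolding A_set_def using assms by (intro sum.union_disjoint) auto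
  then show ?thesis by simp
qed

text \<open>
  The number \<open>m R\<close> has exactly \<open>t\<close> representations up to zeros, one for each multiset of at most
  \<open>R\<close> large elements, and the one belonging to the empty multiset needs length \<open>m R\<close>. The
  parameter \<open>M\<close> is there to make the reflected number popular, by way of
  \<open>rep_count_ge_small\<close>.
\<close>
lemma structure_fails_before:
  assumes l: "3 \<le> ell m" and R: "4 \<le> R" "(R + 1) * ell m \<le> m"
    and M: "(ell m - 1) * M \<le> m" "t \<le> (M + (ell m - 2)) choose (ell m - 2)"
    and t: "t = (ell m + R) choose R"
  shows "\<not> structure_at t (A_set m) (m * R - 1)"
proof
  assume str: "structure_at t (A_set m) (m * R - 1)"
  have "(R + 1) * 1 \<le> (R + 1) * ell m" using l by (intro mult_left_mono) auto
  also have "\<dots> \<le> m" by (rule R(2))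
  finally have Rm: "R < m" by simp
  have "5 * ell m \<le> (R + 1) * ell m" using R(1) by (intro mult_right_mono) auto
  then have lm: "ell m < m" using R(2) l by linarith
  define h where "h = m * R - 1"
  define n where "n = int m * int R"
  define L where "L = {int m - int (ell m) + 1..int m}"
  have mR: "4 * m \<le> m * R" using R(1) mult_le_mono2[of 4 R m] by simp
  have "2 \<le> m * R" using mR Rm R(1) by linarith
  then have h: "int h = n - 1" "1 \<le> h"
    unfolding h_def n_def of_nat_mult[symmetric] by linarith+
  have cardL: "card L = ell m" "finite L" by (auto simp: L_def)
  have L: "L \<subseteq> A_set m" "A_set m = {0, 1} \<union> L" "0 \<notin> L" "1 \<notin> L"
    using lm by (auto simp: L_def A_set_def)
  have sumA: "sum f (A_set m) = f 0 + f 1 + sum f L" for f :: "int \<Rightarrow> int"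
    using sum_A_set_large[of m f] l lm by (simp add: L_def)
  have sumA_nat: "sum f (A_set m) = f 0 + f 1 + sum f L" for f :: "int \<Rightarrow> nat"
    using sum_A_set_large[of m f] l lm by (simp add: L_def)
  have Max: "Max (A_set m) = int m" using l lm by (intro Max_A_set) auto
  have sub: "A_set m \<subseteq> {0..int m}" using l lm by (intro A_set_subset) auto
  have t': "t = (R + ell m) choose ell m"
    using t binomial_symmetric[of R "ell m + R"] by (simp add: add.commute)
  have t1: "1 \<le> t" by (simp add: t' Suc_le_eq)

  have "t \<le> rep_count (A_set m) (m * R) n"
    unfolding t' cardL(1)[symmetric]
  proof (rule rep_count_ge_choose)
    fix k assume k: "k \<in> multisets_upto L R"
    define K where "K = (\<Sum>a\<in>L. int (k a))"
    define S where "S = (\<Sum>a\<in>L. int (k a) * a)"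
    have K: "K \<le> int R" using k unfolding K_def of_nat_sum[symmetric] of_nat_le_iff
      by (simp add: multisets_upto_def)
    have "K \<le> S" unfolding K_def S_def
    proof (rule sum_mono)
      fix a assume "a \<in> L"
      then show "int (k a) \<le> int (k a) * a"
        using lm mult_left_mono[of 1 a "int (k a)"] by (simp add: L_def)
    qed
    have "S \<le> (\<Sum>a\<in>L. int (k a) * int m)"
      unfolding S_def by (intro sum_mono mult_left_mono) (auto simp: L_def)
    also have "\<dots> = K * int m" by (simp add: K_def sum_distrib_right)
    also have "\<dots> \<le> int R * int m" using K by (rule mult_right_mono) simp
    also have "\<dots> = n" by (simp add: n_def)
    finally have "S \<le> n" .
    define k' where "k' = (\<lambda>a. if a \<in> L then k a else if a = 0 then nat (S - K)
      else if a = 1 then nat (n - S) else undefined)"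
    have k'_L: "k' a = k a" if "a \<in> L" for a using that by (simp add: k'_def)
    have k'_ends: "k' 0 = nat (S - K)" "k' 1 = nat (n - S)" using L by (auto simp: k'_def)
    have "int (sum k' (A_set m)) = int (m * R)"
      unfolding of_nat_sum sumA k'_ends using \<open>K \<le> S\<close> \<open>S \<le> n\<close>
      by (simp add: k'_L K_def n_def)
    moreover have "(\<Sum>a\<in>A_set m. int (k' a) * a) = n"
      unfolding sumA k'_ends using \<open>S \<le> n\<close> by (simp add: k'_L S_def)
    moreover have "k' \<in> A_set m \<rightarrow>\<^sub>E UNIV"
      unfolding L(2) by (auto simp: k'_def PiE_def extensional_def)
    ultimately have "k' \<in> reps (A_set m) (m * R) n"
      unfolding reps_def of_nat_eq_iff by blast
    then show "\<exists>k'\<in>reps (A_set m) (m * R) n. \<forall>b\<in>L. k' b = k b"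
      using k'_L by blast
  qed (use L(1) in auto)
  then have pop: "n \<in> popular t (A_set m)"
    unfolding popular_iff using mR Rm by (auto simp: n_def intro!: exI[of _ "m * R"])

  have "2 * int m \<le> int h - int R"
  proof -
    have "4 * int m \<le> n"
      unfolding n_def using R(1) mult_left_mono[of 4 "int R" "int m"] by simp
    then show ?thesis using Rm h(1) by linarith
  qed
  then have slack: "2 * int m * int m \<le> int h * int m - n"
    using mult_right_mono[of "2 * int m" "int h - int R" "int m"]
    by (simp add: n_def algebra_simps)
  have "0 \<le> 2 * int m * int m" by simp
  then have n_le: "n \<le> int h * int m" using slack by linarith
  \<comment> \<open>Adding \<open>M\<close> copies of \<open>m\<close> raises \<open>n\<close> by \<open>M m\<close> and the length by \<open>M\<close>. This leaves \<open>h m - n\<close>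
    unchanged and makes the number large enough for \<open>rep_count_ge_small\<close>.\<close>
  have "t \<le> rep_count (A_set m) (h + M) (n + int M * int m)"
    using slack by (intro order_trans[OF M(2) rep_count_ge_small[OF l lm M(1)]])
      (auto simp: n_def algebra_simps)
  also have "\<dots> = rep_count (reflect (int m) (A_set m)) (h + M) (int h * int m - n)"
    using rep_count_reflect[of "A_set m" "int m" "h + M" "n + int M * int m"]
    by (simp add: algebra_simps)
  finally have pop': "int h * int m - n \<in> popular t (reflect (int m) (A_set m))"
    unfolding popular_iff using n_le h(2) by (auto intro!: exI[of _ "h + M"])

  \<comment> \<open>The large part determines the number of ones from the sum and then the number of zeros
    from the length; it is never empty since \<open>h < n\<close>.\<close>
  have "rep_count (A_set m) h n \<le> card (multisets_upto L R - {\<lambda>a\<in>L. 0})"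
    unfolding rep_count_eq_card_reps
  proof (rule card_inj_on_le)
    show "inj_on (\<lambda>k. restrict k L) (reps (A_set m) h n)"
    proof (rule inj_onI)
      fix k k' assume k: "k \<in> reps (A_set m) h n" "k' \<in> reps (A_set m) h n"
        and eq: "restrict k L = restrict k' L"
      have eqL: "k a = k' a" if "a \<in> L" for a using fun_cong[OF eq, of a] that by simp
      have "int (k 1) + (\<Sum>a\<in>L. int (k' a) * a) = int (k' 1) + (\<Sum>a\<in>L. int (k' a) * a)"
        using k by (simp add: reps_def sumA eqL)
      then have "k 1 = k' 1" by simp
      moreover have "k 0 + k 1 + sum k' L = k' 0 + k' 1 + sum k' L"
        using k by (simp add: reps_def sumA_nat eqL)
      ultimately have ends: "k 0 = k' 0" "k 1 = k' 1" by simp_all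
      show "k = k'"
      proof
        fix a show "k a = k' a"
          using ends eqL k L(2)
          by (cases "a \<in> A_set m") (auto simp: reps_def PiE_def extensional_def)
      qed
    qed
    show "(\<lambda>k. restrict k L) ` reps (A_set m) h n \<subseteq> multisets_upto L R - {\<lambda>a\<in>L. 0}"
    proof clarify
      fix k assume k: "k \<in> reps (A_set m) h n"
      define K where "K = (\<Sum>a\<in>L. k a)"
      have S: "int (k 1) + (\<Sum>a\<in>L. int (k a) * a) = n"
        using k by (simp add: reps_def sumA)
      have "int K * (int m - int (ell m) + 1) \<le> (\<Sum>a\<in>L. int (k a) * a)"
        unfolding K_def of_nat_sum sum_distrib_right
        by (intro sum_mono mult_left_mono) (auto simp: L_def)
      then have KR: "int K * (int m - int (ell m) + 1) \<le> n" using S by linarith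
      have "K \<le> R"
      proof (rule ccontr)
        assume "\<not> K \<le> R"
        then have "(int R + 1) * (int m - int (ell m) + 1) \<le> int K * (int m - int (ell m) + 1)"
          using lm by (intro mult_right_mono) auto
        moreover have "(int R + 1) * int (ell m) \<le> int m"
          using R(2) by (metis of_nat_1 of_nat_add of_nat_le_iff of_nat_mult)
        ultimately show False using KR by (simp add: n_def algebra_simps)
      qed
      moreover have "restrict k L \<noteq> (\<lambda>a\<in>L. 0)"
      proof
        assume "restrict k L = (\<lambda>a\<in>L. 0)"
        then have "k a = 0" if "a \<in> L" for a using that by (metis restrict_apply')
        then have "int (k 1) = n" using S by simp
        moreover have "k 1 \<le> h" using k by (simp add: reps_def sumA_nat)
        ultimately show False using h by simp
      qed
      ultimately show "restrict k L \<in> multisets_upto L R - {\<lambda>a\<in>L. 0}"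
        by (simp add: multisets_upto_def K_def)
    qed
  qed (use finite_multisets_upto[OF cardL(2)] in auto)
  also have "\<dots> = t - 1"
    by (subst card_Diff_singleton)
       (auto simp: multisets_upto_def[of L R] t' cardL card_multisets_upto[OF cardL(2), unfolded multisets_upto_def])
  finally have "\<not> t \<le> rep_count (A_set m) h n" using t1 by simp
  moreover have "0 \<le> n" by (simp add: n_def)
  ultimately show False
    using str pop pop' sub h n_le t1 unfolding h_def[symmetric]
    by (subst (asm) structure_at_iff) (auto simp: Max)
qed

lemma threshold_bounds:
  assumes l: "3 \<le> ell m" and R: "4 \<le> R_par m" "(R_par m + 1) * ell m \<le> m"
    and M: "4 \<le> M" "(ell m - 1) * M \<le> m" "t_par m \<le> (M + (ell m - 2)) choose (ell m - 2)"
  shows "m * R_par m \<le> threshold (t_par m) (A_set m)" "threshold (t_par m) (A_set m) \<le> m * M"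
proof -
  let ?P = "\<lambda>h0. 1 \<le> h0 \<and> (\<forall>h\<ge>h0. structure_at (t_par m) (A_set m) h)"
  have "5 * ell m \<le> (R_par m + 1) * ell m" using R(1) by (intro mult_right_mono) auto
  then have lm: "ell m < m" using R(2) l by linarith
  have t1: "1 \<le> t_par m" by (simp add: t_par_def Suc_le_eq)
  have P: "?P (m * M)"
    using structure_at_A_set[OF l lm M(2,1) t1 M(3)] lm M(1) by (simp add: Suc_le_eq)
  then show "threshold (t_par m) (A_set m) \<le> m * M"
    unfolding threshold_def by (rule Least_le)
  have "?P (threshold (t_par m) (A_set m))"
    unfolding threshold_def using P by (rule LeastI)
  moreover have "\<not> structure_at (t_par m) (A_set m) (m * R_par m - 1)"
    by (rule structure_fails_before[OF l R M(2,3)]) (simp add: t_par_def)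
  ultimately have "\<not> threshold (t_par m) (A_set m) \<le> m * R_par m - 1"
    by blast
  then show "m * R_par m \<le> threshold (t_par m) (A_set m)" by linarith
qed

section \<open>Binomial coefficients and factorials\<close>

text \<open>
  The ratio of the two binomial coefficients is the product of \<open>(M + i) / (R + i)\<close> for
  \<open>1 \<le> i \<le> k\<close>, and each factor is at least \<open>(M + K) / (R + K)\<close>. The free parameter \<open>K\<close> makes
  induction on \<open>k\<close> possible.
\<close>
lemma binomial_ratio_ge:
  assumes "R \<le> M" "k \<le> K"
  shows "real ((R + k) choose k) * (real M + real K) ^ k \<le> real ((M + k) choose k) * (real R + real K) ^ k"
  using assms(2)
proof (induction k)
  case (Suc k)
  have rec: "real ((N + Suc k) choose Suc k) = real ((N + k) choose k) * ((real N + real k + 1) / (real k + 1))" for N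
  proof -
    have "real (Suc k * (Suc (N + k) choose Suc k)) = real (Suc (N + k) * ((N + k) choose k))"
      by (simp only: Suc_times_binomial)
    then have "(real k + 1) * real ((N + Suc k) choose Suc k) = (real N + real k + 1) * real ((N + k) choose k)"
      by (simp only: of_nat_mult of_nat_Suc of_nat_add add_Suc_right add.assoc add.commute[of 1])
    then show ?thesis
      by (simp only: times_divide_eq_right) (simp add: eq_divide_eq mult.commute del: binomial_Suc_Suc)
  qed
  have "0 \<le> (real M - real R) * (real K - real k - 1)"
    using assms(1) Suc.prems by (intro mult_nonneg_nonneg) auto
  then have step: "(real R + real k + 1) * (real M + real K) \<le> (real M + real k + 1) * (real R + real K)"
    by (simp add: algebra_simps)
  have "real ((R + k) choose k) * (real M + real K) ^ k * ((real R + real k + 1) * (real M + real K))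
     \<le> real ((M + k) choose k) * (real R + real K) ^ k * ((real M + real k + 1) * (real R + real K))"
    using Suc.IH Suc.prems step by (intro mult_mono[of _ _ "(real R + real k + 1) * (real M + real K)"]) simp_all
  from divide_right_mono[OF this, of "real k + 1"] show ?case
    unfolding rec by (simp add: mult_ac)
qed simp

lemma binomial_add_2_le: "real ((R + (k + 2)) choose (k + 2)) \<le> real ((R + k) choose k) * (real R + real k + 2) ^ 2"
proof -
  have rec: "real ((R + Suc k) choose Suc k) \<le> real ((R + k) choose k) * (real R + real k + 1)" for k
  proof -
    have "real ((R + Suc k) choose Suc k) \<le> real (Suc k * (Suc (R + k) choose Suc k))"
      by (simp del: binomial_Suc_Suc)
    also have "\<dots> = real ((R + k) choose k) * (real R + real k + 1)"
      unfolding Suc_times_binomial by (simp add: algebra_simps)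
    finally show ?thesis .
  qed
  have "real ((R + (k + 2)) choose (k + 2)) \<le> real ((R + (k + 1)) choose (k + 1)) * (real R + real k + 2)"
    using rec[of "Suc k"] by (simp add: add.commute del: binomial_Suc_Suc)
  also have "\<dots> \<le> (real ((R + k) choose k) * (real R + real k + 1)) * (real R + real k + 2)"
    using rec[of k] by (intro mult_right_mono) (auto simp: add.commute simp del: binomial_Suc_Suc)
  also have "\<dots> \<le> (real ((R + k) choose k) * (real R + real k + 2)) * (real R + real k + 2)"
    by (intro mult_right_mono mult_left_mono) auto
  finally show ?thesis by (simp add: power2_eq_square mult.assoc)
qed

lemma power_le_choose_fact: "real R ^ k \<le> real ((R + k) choose k) * fact k"
proof (induction k)
  case (Suc k)
  have "real R ^ Suc k \<le> real ((R + k) choose k) * fact k * (real R + real k + 1)"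
    using mult_mono[OF Suc, of "real R" "real R + real k + 1"] by (simp add: mult.commute)
  also have "\<dots> = real (Suc (R + k) * (R + k choose k)) * fact k"
    by (simp add: algebra_simps)
  also have "\<dots> = real ((R + Suc k) choose Suc k) * fact (Suc k)"
    unfolding Suc_times_binomial[symmetric] by (simp add: algebra_simps del: binomial_Suc_Suc)
  finally show ?case .
qed simp

text \<open>
  The left-hand side divided by \<open>fact n\<close> is a single term of the exponential series.
\<close>
lemma power_le_exp_fact: "real n ^ n \<le> exp (real n) * fact n"
proof -
  have "real n ^ n / fact n \<le> exp (real n)"
  proof -
    have "(\<Sum>i\<in>{n}. real n ^ i /\<^sub>R fact i) \<le> (\<Sum>i. real n ^ i /\<^sub>R fact i)"
      by (intro sum_le_suminf summable_exp_generic) auto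
    then show ?thesis by (simp add: exp_def field_simps)
  qed
  then show ?thesis by (simp add: field_simps)
qed

text \<open>
  The other half of a weak Stirling formula; the factor \<open>exp 1 * n\<close> disappears when \<open>n\<close>-th roots
  are taken. The induction step amounts to \<open>e \<le> (1 + 1 / n)\<^bsup>n + 1\<^esup>\<close>.
\<close>
lemma exp_fact_le: "1 \<le> n \<Longrightarrow> exp (real n) * fact n \<le> exp 1 * real n * real n ^ n"
proof (induction n rule: nat_induct_at_least)
  case (Suc n)
  have "exp (1 / (real n + 1)) ^ Suc n \<le> ((real n + 1) / real n) ^ Suc n"
  proof (rule power_mono)
    have "1 - 1 / (real n + 1) \<le> exp (- (1 / (real n + 1)))"
      using exp_ge_add_one_self[of "- (1 / (real n + 1))"] by simp
    moreover have "1 - 1 / (real n + 1) = real n / (real n + 1)" by (simp add: field_simps)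
    ultimately show "exp (1 / (real n + 1)) \<le> (real n + 1) / real n"
      using Suc.hyps by (simp add: exp_minus field_simps)
  qed simp
  then have "exp 1 \<le> ((real n + 1) / real n) ^ Suc n"
    by (simp only: exp_of_nat_mult[symmetric]) (simp add: add.commute)
  then have e: "exp 1 * real n ^ Suc n \<le> (real n + 1) ^ Suc n"
    using Suc.hyps by (simp only: power_divide) (simp add: pos_le_divide_eq del: power_Suc)
  have "exp (real (Suc n)) * fact (Suc n) = exp 1 * (real n + 1) * (exp (real n) * fact n)"
    by (simp add: exp_add)
  also have "\<dots> \<le> exp 1 * (real n + 1) * (exp 1 * real n * real n ^ n)"
    using Suc.IH by (intro mult_left_mono) auto
  also have "\<dots> = exp 1 * (real n + 1) * (exp 1 * real n ^ Suc n)" by simp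
  also have "\<dots> \<le> exp 1 * (real n + 1) * (real n + 1) ^ Suc n"
    using e by (intro mult_left_mono) auto
  finally show ?case by (simp add: add.commute)
qed simp

text \<open>
  The binomial coefficient lies between \<open>R\<^sup>k / k!\<close> and \<open>(R + k)\<^sup>k / k!\<close>, and \<open>k!\<close> has \<open>k\<close>-th root close
  to \<open>k / e\<close>.
\<close>
lemma root_choose_bounds:
  fixes R k :: nat
  assumes "1 \<le> k"
  defines "x \<equiv> real ((R + k) choose k) powr (1 / real k)"
  shows "exp 1 * real R / real k * (exp 1 * real k) powr (- 1 / real k) \<le> x"
    and "x \<le> exp 1 * (real R + real k) / real k"
proof -
  let ?C = "real ((R + k) choose k)"
  have expk: "exp (real k) = exp 1 ^ k" using exp_of_nat_mult[of k 1] by simp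
  have root: "y = (y ^ k) powr (1 / real k)" if "0 \<le> y" for y :: real
    using assms that powr_inverse_root[of k "y ^ k"] by (simp add: real_root_power_cancel)
  have "?C * real k ^ k \<le> ?C * (exp (real k) * fact k)"
    by (intro mult_left_mono power_le_exp_fact) auto
  also have "\<dots> = exp (real k) * (?C * fact k)" by simp
  also have "\<dots> \<le> exp (real k) * (real R + real k) ^ k"
  proof (rule mult_left_mono)
    have "real (((R + k) choose k) * fact k) \<le> real ((R + k) ^ k)"
      by (rule of_nat_mono[OF binomial_fact_pow])
    then show "?C * fact k \<le> (real R + real k) ^ k" by simp
  qed simp
  finally have "?C \<le> (exp 1 * (real R + real k) / real k) ^ k"
    using assms by (simp add: power_mult_distrib power_divide expk pos_le_divide_eq)
  then have "x \<le> ((exp 1 * (real R + real k) / real k) ^ k) powr (1 / real k)"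
    unfolding x_def by (intro powr_mono2) auto
  then show "x \<le> exp 1 * (real R + real k) / real k"
    by (simp flip: root)
  have "exp (real k) * real R ^ k \<le> exp (real k) * (?C * fact k)"
    by (intro mult_left_mono power_le_choose_fact) auto
  also have "\<dots> = ?C * (exp (real k) * fact k)" by simp
  also have "\<dots> \<le> ?C * (exp 1 * real k * real k ^ k)"
    using assms by (intro mult_left_mono exp_fact_le) auto
  finally have "(exp 1 * real R / real k) ^ k \<le> ?C * (exp 1 * real k)"
    using assms by (simp add: power_mult_distrib power_divide expk pos_divide_le_eq mult.assoc)
  then have "((exp 1 * real R / real k) ^ k) powr (1 / real k) \<le> (?C * (exp 1 * real k)) powr (1 / real k)"
    by (intro powr_mono2) auto
  then have "exp 1 * real R / real k \<le> x * (exp 1 * real k) powr (1 / real k)"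
    unfolding x_def by (subst (asm) root[symmetric]) (auto simp: powr_mult)
  then show "exp 1 * real R / real k * (exp 1 * real k) powr (- 1 / real k) \<le> x"
    using assms by (simp add: powr_minus field_simps)
qed

section \<open>Asymptotics of the parameters\<close>

text \<open>
  This is the \<open>M\<close> of the upper bound. The exponent \<open>2/5\<close> is below \<open>1/2\<close>, so that \<open>M \<sim> R\<close>, and large
  enough for \<open>(1 + m\<^bsup>2/5\<^esup> / R)\<^sup>l\<close>, which is roughly \<open>exp (m\<^bsup>2/5 - 1/2 + 100/201\<^esup>)\<close>, to exceed every
  power of \<open>m\<close>.
\<close>
definition slack_par :: "nat \<Rightarrow> nat" where
  "slack_par m = R_par m + nat \<lceil>real m powr (2/5)\<rceil>"

lemma parameter_bounds:
  shows "real (ell m) \<le> real m powr (100/201)" "real m powr (100/201) - 1 \<le> real (ell m)"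
    "real (R_par m) \<le> real m powr (1 / 2)" "real m powr (1 / 2) - 1 \<le> real (R_par m)"
    "real (R_par m) + real m powr (2/5) \<le> real (slack_par m)"
    "real (slack_par m) \<le> real (R_par m) + real m powr (2/5) + 1"
proof -
  have expo: "1 / 2.01 = (100/201 :: real)" by simp
  have "0 \<le> \<lfloor>real m powr (100/201)\<rfloor>" "0 \<le> \<lfloor>real m powr (1/2)\<rfloor>" "0 \<le> \<lceil>real m powr (2/5)\<rceil>"
    using powr_ge_zero[of "real m"] by (simp_all add: less_le_trans[of "-1" 0])
  then show "real (ell m) \<le> real m powr (100/201)" "real m powr (100/201) - 1 \<le> real (ell m)"
    "real (R_par m) \<le> real m powr (1 / 2)" "real m powr (1 / 2) - 1 \<le> real (R_par m)"
    "real (R_par m) + real m powr (2/5) \<le> real (slack_par m)"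
    "real (slack_par m) \<le> real (R_par m) + real m powr (2/5) + 1"
    unfolding ell_def expo R_par_def slack_par_def of_nat_add by linarith+
qed

lemma eventually_parameters:
  "eventually (\<lambda>m. 3 \<le> ell m \<and> 4 \<le> R_par m \<and> ell m \<le> R_par m \<and> (R_par m + 1) * ell m \<le> m
     \<and> (ell m - 1) * slack_par m \<le> m) sequentially"
proof -
  have e: "eventually (\<lambda>m::nat. 1 \<le> m \<and> 3 \<le> real m powr (100/201) - 1 \<and> 4 \<le> real m powr (1/2) - 1
     \<and> real m powr (100/201) \<le> real m powr (1/2) - 1
     \<and> (real m powr (1/2) + 1) * real m powr (100/201) \<le> real m
     \<and> real m powr (100/201) * (real m powr (1/2) + real m powr (2/5) + 1) \<le> real m) sequentially"
    by (intro eventually_conj eventually_ge_at_top; real_asymp)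
  show ?thesis
    using e
  proof eventually_elim
    case (elim m)
    note b = parameter_bounds[of m]
    have "(real (R_par m) + 1) * real (ell m) \<le> (real m powr (1/2) + 1) * real m powr (100/201)"
      using elim b by (intro mult_mono) auto
    also have "\<dots> \<le> real m" using elim by blast
    finally have 1: "real ((R_par m + 1) * ell m) \<le> real m" by (simp add: algebra_simps)
    have "real (slack_par m) \<le> real m powr (1/2) + real m powr (2/5) + 1"
      using b by linarith
    moreover have "real (ell m - 1) \<le> real m powr (100/201)"
      using b by linarith
    ultimately have "real (ell m - 1) * real (slack_par m) \<le> real m powr (100/201) * (real m powr (1/2) + real m powr (2/5) + 1)"
      by (intro mult_mono) auto
    also have "\<dots> \<le> real m" using elim by blast
    finally have 2: "real ((ell m - 1) * slack_par m) \<le> real m" by simp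
    have "3 \<le> real (ell m)" "4 \<le> real (R_par m)" "real (ell m) \<le> real (R_par m)"
      using elim b by linarith+
    then show ?case using 1 2 unfolding of_nat_le_iff by simp
  qed
qed

text \<open>
  Removing \<open>m\<close> and \<open>m - 1\<close> from the large elements divides the number of multisets by at most
  \<open>(R + l)\<^sup>2 \<le> 4 m\<close>, while raising the size bound from \<open>R\<close> to \<open>M\<close> multiplies it by at least that much.
\<close>
lemma eventually_t_par_le:
  "eventually (\<lambda>m. t_par m \<le> (slack_par m + (ell m - 2)) choose (ell m - 2)) sequentially"
proof -
  have e: "eventually (\<lambda>m::nat. 1 \<le> m \<and>
     4 * real m \<le> (1 + real m powr (2/5) / (2 * real m powr (1/2))) powr (real m powr (100/201) - 3)) sequentially"
    by (intro eventually_conj eventually_ge_at_top; real_asymp)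
  show ?thesis
    using e eventually_parameters
  proof eventually_elim
    case (elim m)
    note b = parameter_bounds[of m]
    define R M k where "R = R_par m" and "M = slack_par m" and "k = ell m - 2"
    have k: "ell m = k + 2" "k + 2 \<le> R" using elim by (auto simp: k_def R_def)
    have RM: "R \<le> M" by (simp add: R_def M_def slack_par_def)
    have size: "real R + real k + 2 \<le> 2 * real m powr (1/2)"
      using b elim k by (simp add: R_def)
    have sq: "(real m powr (1/2))\<^sup>2 = real m"
      using elim by (simp add: powr_half_sqrt)
    have "(real R + real k + 2) ^ 2 \<le> (2 * real m powr (1/2)) ^ 2"
      using size by (intro power_mono) auto
    then have sq_le: "(real R + real k + 2) ^ 2 \<le> 4 * real m"
      by (simp add: power_mult_distrib sq)
    have pos: "0 < real R + real k" using k by simp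
    have "1 + real m powr (2/5) / (2 * real m powr (1/2)) \<le> 1 + (real M - real R) / (real R + real k)"
    proof (intro add_left_mono frac_le)
      show "0 \<le> real M - real R" using RM by simp
      show "real m powr (2/5) \<le> real M - real R"
        using b(5) unfolding M_def R_def by linarith
      show "real R + real k \<le> 2 * real m powr (1/2)" using size by linarith
    qed (rule pos)
    also have "\<dots> = (real M + real k) / (real R + real k)"
      using pos by (simp add: field_simps)
    finally have base: "1 + real m powr (2/5) / (2 * real m powr (1/2)) \<le> (real M + real k) / (real R + real k)" .
    have "4 * real m \<le> (1 + real m powr (2/5) / (2 * real m powr (1/2))) powr (real m powr (100/201) - 3)"
      using elim by simp
    also have "\<dots> \<le> (1 + real m powr (2/5) / (2 * real m powr (1/2))) powr real k"
      using b elim k by (intro powr_mono) auto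
    also have "\<dots> \<le> ((real M + real k) / (real R + real k)) powr real k"
      using base by (intro powr_mono2) (auto intro: add_nonneg_nonneg)
    also have "\<dots> = (real M + real k) ^ k / (real R + real k) ^ k"
      using pos RM by (simp add: powr_realpow power_divide)
    finally have gain: "4 * real m \<le> (real M + real k) ^ k / (real R + real k) ^ k" .
    have "real (t_par m) = real ((R + (k + 2)) choose (k + 2))"
      using binomial_symmetric[of R "k + 2 + R"] by (simp add: t_par_def k R_def add.commute)
    also have "\<dots> \<le> real ((R + k) choose k) * (real R + real k + 2) ^ 2"
      by (rule binomial_add_2_le)
    also have "\<dots> \<le> real ((R + k) choose k) * ((real M + real k) ^ k / (real R + real k) ^ k)"
      using sq_le gain by (intro mult_left_mono) auto
    also have "\<dots> \<le> real ((M + k) choose k)"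
      using binomial_ratio_ge[OF RM order_refl, of k] pos by (simp add: field_simps)
    finally show ?case by (simp add: M_def k)
  qed
qed

text \<open>
  This is \<open>t\<^bsup>1/l\<^esup> \<sim> e R / l\<close> with \<open>R\<close> and \<open>l\<close> replaced by the powers of \<open>m\<close> they approximate.
\<close>
lemma root_t_par_asymp:
  "(\<lambda>m. real (t_par m) powr (1 / real (ell m)))
     \<sim>[sequentially] (\<lambda>m. exp 1 * real m powr (1/2) / real m powr (100/201))"
proof -
  define f where "f = (\<lambda>m::nat. exp 1 * (real m powr (1/2) - 1) / real m powr (100/201)
      * (exp 1 * real m powr (100/201)) powr (- 1 / (real m powr (100/201) - 1)))"
  define u where "u = (\<lambda>m::nat. exp 1 * (real m powr (1/2) + real m powr (100/201)) / (real m powr (100/201) - 1))"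
  let ?g = "\<lambda>m::nat. exp 1 * real m powr (1/2) / real m powr (100/201)"
  have "eventually (\<lambda>m::nat. 3 \<le> real m powr (100/201) - 1) sequentially" by real_asymp
  then have ev: "eventually (\<lambda>m. f m \<le> real (t_par m) powr (1 / real (ell m)) \<and>
     real (t_par m) powr (1 / real (ell m)) \<le> u m) sequentially"
    using eventually_parameters eventually_ge_at_top[of 1]
  proof eventually_elim
    case (elim m)
    define x y where "x = real m powr (100/201)" and "y = real m powr (1/2)"
    have b: "real (ell m) \<le> x" "x - 1 \<le> real (ell m)" "y - 1 \<le> real (R_par m)"
        "real (R_par m) \<le> y" "4 \<le> x"
      using parameter_bounds[of m] elim unfolding x_def y_def by linarith+
    have t: "t_par m = (R_par m + ell m) choose ell m"
      using binomial_symmetric[of "R_par m" "ell m + R_par m"] by (simp add: t_par_def add.commute)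
    have l: "1 \<le> ell m" using elim by simp
    have "f m \<le> exp 1 * real (R_par m) / real (ell m) * (exp 1 * real (ell m)) powr (- 1 / real (ell m))"
      unfolding f_def x_def[symmetric] y_def[symmetric]
    proof (rule mult_mono)
      show "exp 1 * (y - 1) / x \<le> exp 1 * real (R_par m) / real (ell m)"
        using b l by (intro frac_le mult_left_mono) simp_all
      have "1 * 1 \<le> exp (1::real) * x"
        using b(5) by (intro mult_mono) simp_all
      moreover have "1 / real (ell m) \<le> 1 / (x - 1)"
        using b by (intro frac_le) simp_all
      ultimately have "(exp 1 * x) powr (- 1 / (x - 1)) \<le> (exp 1 * x) powr (- 1 / real (ell m))"
        by (intro powr_mono) simp_all
      also have "\<dots> \<le> (exp 1 * real (ell m)) powr (- 1 / real (ell m))"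
        using b l by (intro powr_mono2') simp_all
      finally show "(exp 1 * x) powr (- 1 / (x - 1))
         \<le> (exp 1 * real (ell m)) powr (- 1 / real (ell m))" .
    qed simp_all
    also have "\<dots> \<le> real (t_par m) powr (1 / real (ell m))"
      unfolding t by (rule root_choose_bounds(1)[OF l])
    finally have 1: "f m \<le> real (t_par m) powr (1 / real (ell m))" .
    have "real (t_par m) powr (1 / real (ell m)) \<le> exp 1 * (real (R_par m) + real (ell m)) / real (ell m)"
      unfolding t by (rule root_choose_bounds(2)[OF l])
    also have "\<dots> \<le> u m"
      unfolding u_def x_def[symmetric] y_def[symmetric]
      using b by (intro frac_le mult_left_mono add_mono) simp_all
    finally show ?case using 1 by simp
  qed
  show ?thesis
  proof (rule asymp_equiv_sandwich_real[of f sequentially ?g u])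
    show "f \<sim>[sequentially] ?g" unfolding f_def by real_asymp
    show "u \<sim>[sequentially] ?g" unfolding u_def by real_asymp
  qed (use ev in \<open>auto elim!: eventually_mono\<close>)
qed

lemma R_par_asymp: "(\<lambda>m. real (R_par m)) \<sim>[sequentially] (\<lambda>m. real m powr (1/2))"
proof (rule asymp_equiv_sandwich_real[OF _ asymp_equiv_refl])
  show "(\<lambda>m::nat. real m powr (1/2) - 1) \<sim>[sequentially] (\<lambda>m. real m powr (1/2))" by real_asymp
qed (use parameter_bounds in auto)

lemma ell_asymp: "(\<lambda>m. real (ell m)) \<sim>[sequentially] (\<lambda>m. real m powr (100/201))"
proof (rule asymp_equiv_sandwich_real[OF _ asymp_equiv_refl])
  show "(\<lambda>m::nat. real m powr (100/201) - 1) \<sim>[sequentially] (\<lambda>m. real m powr (100/201))" by real_asymp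
qed (use parameter_bounds in auto)

lemma slack_par_asymp: "(\<lambda>m. real (slack_par m)) \<sim>[sequentially] (\<lambda>m. real m powr (1/2))"
proof (rule asymp_equiv_sandwich_real)
  show "(\<lambda>m::nat. real m powr (1/2) - 1) \<sim>[sequentially] (\<lambda>m. real m powr (1/2))" by real_asymp
  show "(\<lambda>m::nat. real m powr (1/2) + real m powr (2/5) + 1) \<sim>[sequentially] (\<lambda>m. real m powr (1/2))"
    by real_asymp
  have "real m powr (1/2) - 1 \<le> real (slack_par m)
      \<and> real (slack_par m) \<le> real m powr (1/2) + real m powr (2/5) + 1" for m
    using parameter_bounds[of m] powr_ge_zero[of "real m" "2/5"] by linarith
  then show "eventually (\<lambda>m. real (slack_par m)
      \<in> {real m powr (1/2) - 1..real m powr (1/2) + real m powr (2/5) + 1}) sequentially"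
    by simp
qed

theorem mainTheorem6:
  shows "filterlim (\<lambda>m. real (t_par m) powr (1 / real (ell m))) at_top sequentially \<and>
    (\<lambda>m. real (threshold (t_par m) (A_set m)))
      \<sim>[sequentially]
    (\<lambda>m. 1 / exp 1 * real m * real (ell m) * real (t_par m) powr (1 / real (ell m)))"
proof
  have "filterlim (\<lambda>m::nat. exp 1 * real m powr (1/2) / real m powr (100/201)) at_top sequentially"
    by real_asymp
  then show "filterlim (\<lambda>m. real (t_par m) powr (1 / real (ell m))) at_top sequentially"
    using asymp_equiv_at_top_transfer[OF asymp_equiv_symI[OF root_t_par_asymp]] by blast
next
  let ?T = "\<lambda>m. real (threshold (t_par m) (A_set m))"
  let ?g = "\<lambda>m::nat. real m * real m powr (1/2)"
  have "?T \<sim>[sequentially] ?g"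
  proof (rule asymp_equiv_sandwich_real)
    show "(\<lambda>m. real m * real (R_par m)) \<sim>[sequentially] ?g"
      by (intro asymp_equiv_mult asymp_equiv_refl R_par_asymp)
    show "(\<lambda>m. real m * real (slack_par m)) \<sim>[sequentially] ?g"
      by (intro asymp_equiv_mult asymp_equiv_refl slack_par_asymp)
    show "eventually (\<lambda>m. ?T m \<in> {real m * real (R_par m)..real m * real (slack_par m)}) sequentially"
      using eventually_parameters eventually_t_par_le
    proof eventually_elim
      case (elim m)
      have "4 \<le> slack_par m"
        using elim by (simp add: slack_par_def)
      with elim have "m * R_par m \<le> threshold (t_par m) (A_set m)"
        "threshold (t_par m) (A_set m) \<le> m * slack_par m"
        by (blast intro: threshold_bounds)+
      then show ?case
        unfolding of_nat_mult[symmetric] atLeastAtMost_iff of_nat_le_iff by blast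
    qed
  qed
  also have "?g \<sim>[sequentially] (\<lambda>m. 1 / exp 1 * real m * real (ell m) * real (t_par m) powr (1 / real (ell m)))"
  proof -
    have "(\<lambda>m. 1 / exp 1 * real m * real (ell m) * real (t_par m) powr (1 / real (ell m))) \<sim>[sequentially]
      (\<lambda>m. 1 / exp 1 * real m * real m powr (100/201) * (exp 1 * real m powr (1/2) / real m powr (100/201)))"
      by (intro asymp_equiv_mult asymp_equiv_refl ell_asymp root_t_par_asymp)
    also have "(\<lambda>m. 1 / exp 1 * real m * real m powr (100/201) * (exp 1 * real m powr (1/2) / real m powr (100/201))) = ?g"
      by (auto simp: fun_eq_iff)
    finally show ?thesis by (rule asymp_equiv_symI)
  qed
  finally show "?T \<sim>[sequentially] (\<lambda>m. 1 / exp 1 * real m * real (ell m) * real (t_par m) powr (1 / real (ell m)))" .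
qed

end
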